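(* Let $G=(N,A)$ be a directed graph with $m$ arcs and let $Q\in\mathbb{R}^{m\times m}$ be an incident weak sum matrix with supporting vectors $b,c\in\mathbb{R}^m$. Then $Q$ is linearizable with cost vector $p=b+c$, i.e. $x^TQx=(b+c)^Tx$ for all $x\in X$.
   Context: $G=(N,A)$ is a directed graph, $A\subseteq N\times N$, $|N|=n$, $|A|=m$; matrices and vectors of dimension $m$ are indexed by arcs. For $i\in N$, $\delta^+(i)$ and $\delta^-(i)$ are the sets of arcs leaving and entering $i$. For an arc $e$, $e^+$ is its starting node and $e^-$ its ending node. The set of (disjoint) cycle covers is $$X=\Big\{x\in\{0,1\}^m : \sum_{e\in\delta^+(i)}x_e=\sum_{e\in\delta^-(i)}x_e=1\ \ \forall i\in N\Big\}.$$ $Q$ is linearizable with cost vector $p\in\mathbb{R}^m$ if $x^TQx=p^Tx$ for all $x\in X$. $Q$ is called incident weak sum with supporting vectors $b,c\in\mathbb{R}^m$ if $Q_{ef}=b_e+c_f$ for all $e\in A$, $f\in\delta^+(e^-)$, and $Q_{ef}=0$ otherwise. *)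

theory Defs
  imports
    Complex_Main
    "HOL-Library.FuncSet"
    "Graph_Theory.Pair_Digraph"
begin

text \<open>
  Vectors and matrices indexed by the arcs of \<open>G\<close> are real-valued functions of one or two
  arcs; their values off \<open>parcs G\<close> carry no meaning.
  For an arc \<open>e\<close>, the starting node \<open>e\<^sup>+\<close> is \<open>fst e\<close> and the ending node
  \<open>e\<^sup>-\<close> is \<open>snd e\<close>. The sets \<open>\<delta>\<^sup>+(i)\<close> and \<open>\<delta>\<^sup>-(i)\<close> are \<open>out_arcs G i\<close> and
  \<open>in_arcs G i\<close>. Loops are allowed, as in \<open>A \<subseteq> N \<times> N\<close>; a loop at \<open>i\<close> lies in both sets.
\<close>

type_synonym 'v arc_vec = "'v \<times> 'v \<Rightarrow> real"
type_synonym 'v arc_mat = "'v \<times> 'v \<Rightarrow> 'v \<times> 'v \<Rightarrow> real"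

text \<open>
  The extensional function space makes each 0/1 vector over the arcs have exactly one
  representative.
\<close>

definition cycle_covers :: "'v pair_pre_digraph \<Rightarrow> 'v arc_vec set" where
  "cycle_covers G = {x \<in> parcs G \<rightarrow>\<^sub>E {0, 1}.
     \<forall>i\<in>pverts G. (\<Sum>e\<in>out_arcs G i. x e) = 1 \<and> (\<Sum>e\<in>in_arcs G i. x e) = 1}"

definition linearizable_with ::
  "'v pair_pre_digraph \<Rightarrow> 'v arc_mat \<Rightarrow> 'v arc_vec \<Rightarrow> bool" where
  "linearizable_with G Q p \<longleftrightarrow> (\<forall>x\<in>cycle_covers G.
     (\<Sum>e\<in>parcs G. \<Sum>f\<in>parcs G. x e * Q e f * x f) = (\<Sum>e\<in>parcs G. p e * x e))"

definition incident_weak_sum ::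
  "'v pair_pre_digraph \<Rightarrow> 'v arc_mat \<Rightarrow> 'v arc_vec \<Rightarrow> 'v arc_vec \<Rightarrow> bool" where
  "incident_weak_sum G Q b c \<longleftrightarrow> (\<forall>e\<in>parcs G. \<forall>f\<in>parcs G.
     Q e f = (if f \<in> out_arcs G (snd e) then b e + c f else 0))"

end

theory Submission
  imports Defs
begin

text \<open>
  In \<open>x\<^sup>T Q x\<close> only pairs of consecutive arcs \<open>e, f\<close> contribute, each with \<open>(b e + c f) x e x f\<close>.
  Collect the \<open>b\<close>-part by its first arc and the \<open>c\<close>-part by its second arc. For fixed \<open>e\<close>, the
  factors \<open>x f\<close> run over the arcs leaving the head of \<open>e\<close>, and a cycle cover leaves each node
  exactly once, so what remains is \<open>b e x e\<close>; for fixed \<open>f\<close>, the factors \<open>x e\<close> run over the arcs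
  entering the tail of \<open>f\<close>, and a cycle cover enters each node exactly once, so what remains is
  \<open>c f x f\<close>.
\<close>

text \<open>
  An arc \<open>f\<close> leaves the head of \<open>e\<close> exactly when \<open>e\<close> enters the tail of \<open>f\<close>. Hence, after
  exchanging the order of summation in the \<open>c\<close>-part, all dependence on \<open>G\<close> sits in the weights
  that \<open>x\<close> puts on the arcs leaving or entering single nodes.
\<close>

lemma incident_weak_sum_quadratic_form:
  fixes G :: "'v pair_pre_digraph" and x :: "'v arc_vec"
  assumes "finite (parcs G)" and "incident_weak_sum G Q b c"
  shows "(\<Sum>e\<in>parcs G. \<Sum>f\<in>parcs G. x e * Q e f * x f) =
    (\<Sum>e\<in>parcs G. b e * x e * (\<Sum>f\<in>out_arcs G (snd e). x f)) +
    (\<Sum>f\<in>parcs G. c f * x f * (\<Sum>e\<in>in_arcs G (fst f). x e))"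
proof -
  let ?A = "parcs G"
  have out: "(\<Sum>f\<in>out_arcs G v. x f) = (\<Sum>f\<in>?A. if fst f = v then x f else 0)" for v
    using assms(1) by (simp add: out_arcs_def sum.inter_filter)
  have inn: "(\<Sum>e\<in>in_arcs G v. x e) = (\<Sum>e\<in>?A. if snd e = v then x e else 0)" for v
    using assms(1) by (simp add: in_arcs_def sum.inter_filter)
  have "(\<Sum>e\<in>?A. \<Sum>f\<in>?A. x e * Q e f * x f) =
      (\<Sum>e\<in>?A. \<Sum>f\<in>?A. b e * x e * (if fst f = snd e then x f else 0)
                      + c f * x f * (if snd e = fst f then x e else 0))"
    using assms(2)
    by (intro sum.cong refl) (auto simp: incident_weak_sum_def algebra_simps)
  also have "\<dots> = (\<Sum>e\<in>?A. \<Sum>f\<in>?A. b e * x e * (if fst f = snd e then x f else 0)) +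
      (\<Sum>f\<in>?A. \<Sum>e\<in>?A. c f * x f * (if snd e = fst f then x e else 0))"
    unfolding sum.distrib by (subst (2) sum.swap) (rule refl)
  finally show ?thesis
    by (simp only: out inn sum_distrib_left)
qed

theorem proposition3:
  fixes G :: "'v pair_pre_digraph"
    and Q :: "'v arc_mat"
    and b c :: "'v arc_vec"
  assumes "pair_fin_digraph G"
    and "incident_weak_sum G Q b c"
  shows "linearizable_with G Q (\<lambda>e. b e + c e)"
proof -
  interpret pair_fin_digraph G by fact
  show ?thesis
    unfolding linearizable_with_def
  proof
    fix x assume x: "x \<in> cycle_covers G"
    have leave: "(\<Sum>f\<in>out_arcs G (snd e). x f) = 1" if "e \<in> parcs G" for e
      using x that arc_snd_in_verts unfolding cycle_covers_def by blast
    have enter: "(\<Sum>e\<in>in_arcs G (fst f). x e) = 1" if "f \<in> parcs G" for f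
      using x that arc_fst_in_verts unfolding cycle_covers_def by blast
    show "(\<Sum>e\<in>parcs G. \<Sum>f\<in>parcs G. x e * Q e f * x f) = (\<Sum>e\<in>parcs G. (b e + c e) * x e)"
      unfolding incident_weak_sum_quadratic_form[OF pair_finite_arcs assms(2)]
      by (simp add: leave enter distrib_right sum.distrib)
  qed
qed

end
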